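(* Let $Y,U$ be Banach spaces and $p\in[1,\infty]$. Let $\Sigma$ be an abstract linear control system and $\mathcal{S}$ an abstract nonlinear control system, both with state space $Y$, control space $U$ and exponent $p$. Assume that: (i) there exist constants $\sigma,c,C_L>0$ such that, for all $T>0$ and $y_0\in Y$, there exists $u\in L^p((0,T);U)$ such that $\Sigma_T(y_0,u)=0$ and $\|u\|_{L^p}\le C_L\exp(cT^{-\sigma})\|y_0\|_Y$; (ii) there exist $\gamma>1$ and $C_N>0$ such that, for all $T>0$, $y_0\in Y$ and $u\in L^p((0,T);U)$, $$\|\mathcal{S}_T(y_0,u)-\Sigma_T(y_0,u)\|_Y\le C_N\left(\|y_0\|_Y+\|u\|_{L^p}\right)^\gamma .$$ Then $\mathcal{S}$ is small-time locally null controllable: for every $T,\eta>0$, there exists $\delta>0$ such that, for all $y_0\in Y$ with $\|y_0\|_Y\le\delta$, there exists $u\in L^p((0,T);U)$ with $\|u\|_{L^p}\le\eta$ such that $\mathcal{S}_T(y_0,u)=0$.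
   Context: For $u,v\in L^p(\mathbb{R}_+;U)$ and $\tau\ge0$, the $\tau$-concatenation $u\diamond_\tau v\in L^p(\mathbb{R}_+;U)$ is defined by $(u\diamond_\tau v)(s)=u(s)$ for $s\in[0,\tau)$ and $(u\diamond_\tau v)(s)=v(s-\tau)$ for $s\ge\tau$. An abstract linear control system is a family $(\Sigma_t)_{t\ge0}$ of continuous linear maps from $Y\times L^p(\mathbb{R}_+;U)$ to $Y$ such that: for all $y_0\in Y$ and $u\in L^p(\mathbb{R}_+;U)$, $t\mapsto\Sigma_t(y_0,u)$ is continuous on $\mathbb{R}_+$ with $\Sigma_0(y_0,u)=y_0$; and for all $t,\tau\ge0$, $y_0\in Y$, $u,v\in L^p(\mathbb{R}_+;U)$, $\Sigma_{t+\tau}(y_0,u\diamond_\tau v)=\Sigma_t(\Sigma_\tau(y_0,u),v)$. An abstract nonlinear control system is a family $(\mathcal{S}_t)_{t\ge0}$ of (not necessarily linear or continuous) maps from $Y\times L^p(\mathbb{R}_+;U)$ to $Y$ such that: for all $y_0\in Y$ and $u\in L^p(\mathbb{R}_+;U)$, $t\mapsto\mathcal{S}_t(y_0,u)$ is continuous on $\mathbb{R}_+$ with $\mathcal{S}_0(y_0,u)=y_0$; for all $t\ge0$, $\mathcal{S}_t(0,0)=0$; and for all $t,\tau\ge0$, $y_0\in Y$, $u,v\in L^p(\mathbb{R}_+;U)$, $\mathcal{S}_{t+\tau}(y_0,u\diamond_\tau v)=\mathcal{S}_t(\mathcal{S}_\tau(y_0,u),v)$. By the composition properties, $\Sigma_T(y_0,u)$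 and $\mathcal{S}_T(y_0,u)$ depend only on $u|_{(0,T)}$, so they make sense for $u\in L^p((0,T);U)$ (extend $u$ by $0$). *)

theory Defs
  imports "HOL-Analysis.Analysis" "HOL-Probability.Essential_Supremum"
begin

text \<open>
  Strong (Bochner) measurability.  The library's \<^const>\<open>borel_measurable\<close> is not the right notion
  here, since the target Banach space is not assumed to be separable.
\<close>

definition strongly_measurable :: "'a measure \<Rightarrow> ('a \<Rightarrow> 'b::banach) \<Rightarrow> bool" where
  "strongly_measurable M f \<longleftrightarrow>
     (\<exists>s. (\<forall>n::nat. simple_function M (s n)) \<and> (AE x in M. (\<lambda>n. s n x) \<longlonglongrightarrow> f x))"

text \<open>
  \<open>Lp_space\<close> consists of representatives; the identification of almost everywhere equal functions
  is imposed as a compatibility condition (\<open>Lp_map\<close> below) on the maps defined on it.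
\<close>

definition Lp_space :: "ennreal \<Rightarrow> 'a measure \<Rightarrow> ('a \<Rightarrow> 'b::banach) set" where
  "Lp_space p M =
     {f. strongly_measurable M f \<and>
         (if p = \<infinity> then esssup M (\<lambda>x. ennreal (norm (f x))) < \<infinity>
          else integrable M (\<lambda>x. norm (f x) powr enn2real p))}"

definition Lp_norm :: "ennreal \<Rightarrow> 'a measure \<Rightarrow> ('a \<Rightarrow> 'b::banach) \<Rightarrow> real" where
  "Lp_norm p M f =
     (if p = \<infinity> then enn2real (esssup M (\<lambda>x. ennreal (norm (f x))))
      else (integral\<^sup>L M (\<lambda>x. norm (f x) powr enn2real p)) powr (1 / enn2real p))"

abbreviation half_line :: "real measure" where
  "half_line \<equiv> lebesgue_on {0..}"

abbreviation horizon :: "real \<Rightarrow> real measure" where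
  "horizon T \<equiv> lebesgue_on {0<..<T}"

definition concatenation :: "real \<Rightarrow> (real \<Rightarrow> 'u) \<Rightarrow> (real \<Rightarrow> 'u) \<Rightarrow> real \<Rightarrow> 'u" where
  "concatenation \<tau> u v = (\<lambda>s. if s < \<tau> then u s else v (s - \<tau>))"

definition zero_extension :: "real \<Rightarrow> (real \<Rightarrow> 'u::zero) \<Rightarrow> real \<Rightarrow> 'u" where
  "zero_extension T u = (\<lambda>s. if s \<in> {0<..<T} then u s else 0)"

text \<open>
  A map on \<open>Y \<times> L\<^sup>p(\<real>\<^sub>+; U)\<close>: a function of representatives that is well defined on
  almost everywhere classes.  Its values at controls outside \<open>Lp_space\<close> are irrelevant.
\<close>

definition Lp_map :: "ennreal \<Rightarrow> ('y::banach \<times> (real \<Rightarrow> 'u::banach) \<Rightarrow> 'y) \<Rightarrow> bool" where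
  "Lp_map p F \<longleftrightarrow>
     (\<forall>y. \<forall>u \<in> Lp_space p half_line. \<forall>v \<in> Lp_space p half_line.
        (AE s in half_line. u s = v s) \<longrightarrow> F (y, u) = F (y, v))"

definition Lp_linear :: "ennreal \<Rightarrow> ('y::banach \<times> (real \<Rightarrow> 'u::banach) \<Rightarrow> 'y) \<Rightarrow> bool" where
  "Lp_linear p F \<longleftrightarrow>
     (\<forall>y z. \<forall>u \<in> Lp_space p half_line. \<forall>v \<in> Lp_space p half_line.
        F (y + z, \<lambda>s. u s + v s) = F (y, u) + F (z, v)) \<and>
     (\<forall>a::real. \<forall>y. \<forall>u \<in> Lp_space p half_line.
        F (a *\<^sub>R y, \<lambda>s. a *\<^sub>R u s) = a *\<^sub>R F (y, u))"

definition Lp_continuous :: "ennreal \<Rightarrow> ('y::banach \<times> (real \<Rightarrow> 'u::banach) \<Rightarrow> 'y) \<Rightarrow> bool" where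
  "Lp_continuous p F \<longleftrightarrow>
     (\<forall>y. \<forall>u \<in> Lp_space p half_line. \<forall>\<epsilon>>0. \<exists>\<delta>>0. \<forall>z. \<forall>v \<in> Lp_space p half_line.
        norm (z - y) < \<delta> \<and> Lp_norm p half_line (\<lambda>s. v s - u s) < \<delta> \<longrightarrow>
        norm (F (z, v) - F (y, u)) < \<epsilon>)"

definition control_flow ::
    "ennreal \<Rightarrow> (real \<Rightarrow> 'y::banach \<times> (real \<Rightarrow> 'u::banach) \<Rightarrow> 'y) \<Rightarrow> bool" where
  "control_flow p F \<longleftrightarrow>
     (\<forall>t\<ge>0. Lp_map p (F t)) \<and>
     (\<forall>y\<^sub>0. \<forall>u \<in> Lp_space p half_line.
        continuous_on {0..} (\<lambda>t. F t (y\<^sub>0, u)) \<and> F 0 (y\<^sub>0, u) = y\<^sub>0) \<and>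
     (\<forall>t\<ge>0. \<forall>\<tau>\<ge>0. \<forall>y\<^sub>0. \<forall>u \<in> Lp_space p half_line. \<forall>v \<in> Lp_space p half_line.
        F (t + \<tau>) (y\<^sub>0, concatenation \<tau> u v) = F t (F \<tau> (y\<^sub>0, u), v))"

definition linear_control_system ::
    "ennreal \<Rightarrow> (real \<Rightarrow> 'y::banach \<times> (real \<Rightarrow> 'u::banach) \<Rightarrow> 'y) \<Rightarrow> bool" where
  "linear_control_system p \<Sigma> \<longleftrightarrow>
     control_flow p \<Sigma> \<and> (\<forall>t\<ge>0. Lp_linear p (\<Sigma> t) \<and> Lp_continuous p (\<Sigma> t))"

definition nonlinear_control_system ::
    "ennreal \<Rightarrow> (real \<Rightarrow> 'y::banach \<times> (real \<Rightarrow> 'u::banach) \<Rightarrow> 'y) \<Rightarrow> bool" where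
  "nonlinear_control_system p \<S> \<longleftrightarrow>
     control_flow p \<S> \<and> (\<forall>t\<ge>0. \<S> t (0, \<lambda>_. 0) = 0)"

definition small_time_locally_null_controllable ::
    "ennreal \<Rightarrow> (real \<Rightarrow> 'y::banach \<times> (real \<Rightarrow> 'u::banach) \<Rightarrow> 'y) \<Rightarrow> bool" where
  "small_time_locally_null_controllable p \<S> \<longleftrightarrow>
     (\<forall>T>0. \<forall>\<eta>>0. \<exists>\<delta>>0. \<forall>y\<^sub>0. norm y\<^sub>0 \<le> \<delta> \<longrightarrow>
        (\<exists>u \<in> Lp_space p (horizon T).
           Lp_norm p (horizon T) u \<le> \<eta> \<and> \<S> T (y\<^sub>0, zero_extension T u) = 0))"

end

theory Submission imports Defs begin

text \<open>
  Fix \<open>1 < q < \<gamma>\<close> and split \<open>(0, T)\<close> into intervals whose lengths \<open>\<tau> k\<close> decrease geometrically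
  so slowly that \<open>\<tau> k powr (- \<sigma>) = A * q ^ k\<close>. On the \<open>k\<close>-th interval apply the control that steers the
  linear system from the current state to zero. The state reached by the nonlinear system is then
  just the linearization error, so \<open>norm (y (k + 1)) \<le> C * exp (\<gamma> * c * A * q ^ k) * norm (y k) powr \<gamma>\<close>.
  As \<open>q < \<gamma>\<close>, the bound \<open>norm (y k) \<le> exp (- \<beta> * q ^ k - D)\<close> propagates once \<open>\<beta>\<close> and \<open>D\<close> are
  large; it beats the control cost \<open>exp (c * A * q ^ k)\<close>, so the controls are summable with a sum as
  small as desired, and continuity in time gives the state \<open>0\<close> at time \<open>T\<close>.
\<close>

section \<open>Norm bounds in Lp\<close>

text \<open>
  For a complete measure, \<open>Lp_bounded p M c f\<close> says that \<open>f\<close> lies in \<open>L\<^sup>p\<close> with norm at most \<open>c\<close>;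
  stating it with \<open>nn_integral\<close> avoids integrability side conditions.
\<close>

definition Lp_bounded :: "ennreal \<Rightarrow> 'a measure \<Rightarrow> real \<Rightarrow> ('a \<Rightarrow> 'b::banach) \<Rightarrow> bool" where
  "Lp_bounded p M c f \<longleftrightarrow> strongly_measurable M f \<and>
     (if p = \<infinity> then AE x in M. norm (f x) \<le> c
      else (\<integral>\<^sup>+x. ennreal (norm (f x) powr enn2real p) \<partial>M) \<le> ennreal (c powr enn2real p))"

text \<open>The preimages of a Borel set under \<open>h\<close> and \<open>g\<close> agree up to a
  null set, so completeness passes measurability from one to the other.\<close>

lemma (in complete_measure) borel_measurable_AE_eq:
  fixes h g :: "'a \<Rightarrow> 'b::topological_space"
  assumes h: "h \<in> borel_measurable M" and ae: "AE x in M. h x = g x"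
  shows "g \<in> borel_measurable M"
proof (rule measurableI)
  fix A :: "'b set" assume A: "A \<in> sets borel"
  show "g -` A \<inter> space M \<in> sets M"
  proof (rule in_sets_AE[of "h -` A \<inter> space M"])
    show "AE x in M. (x \<in> h -` A \<inter> space M) = (x \<in> g -` A \<inter> space M)"
      using ae by eventually_elim auto
    show "h -` A \<inter> space M \<in> sets M"
      using h A by (rule measurable_sets)
  qed auto
qed auto

text \<open>The norms of the approximating simple functions are measurable real functions. Setting
  them to 0 on the exceptional null set turns almost everywhere convergence into pointwise
  convergence, and completeness then removes this change.\<close>

lemma (in complete_measure) borel_measurable_norm_strongly_measurable:
  assumes "strongly_measurable M f"
  shows "(\<lambda>x. norm (f x)) \<in> borel_measurable M"
proof -
  obtain s where s: "\<And>n::nat. simple_function M (s n)"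
    and lim: "AE x in M. (\<lambda>n. s n x) \<longlonglongrightarrow> f x"
    using assms unfolding strongly_measurable_def by blast
  define N where "N = {x \<in> space M. \<not> (\<lambda>n. s n x) \<longlonglongrightarrow> f x}"
  have N: "N \<in> null_sets M"
    using lim unfolding AE_iff_null_sets N_def .
  have [measurable]: "(\<lambda>x. norm (s n x)) \<in> borel_measurable M" for n
    using simple_function_compose1[OF s] by (rule borel_measurable_simple_function)
  have [measurable]: "N \<in> sets M" using N by auto
  show ?thesis
  proof (rule borel_measurable_AE_eq)
    show "(\<lambda>x. if x \<in> N then 0 else norm (f x)) \<in> borel_measurable M"
    proof (rule borel_measurable_LIMSEQ_real)
      show "(\<lambda>x. if x \<in> N then 0 else norm (s n x)) \<in> borel_measurable M" for n
        by measurable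
      show "(\<lambda>n. if x \<in> N then 0 else norm (s n x)) \<longlonglongrightarrow> (if x \<in> N then 0 else norm (f x))"
        if "x \<in> space M" for x
        using that by (auto simp: N_def intro: tendsto_norm)
    qed
    show "AE x in M. (if x \<in> N then 0 else norm (f x)) = norm (f x)"
      using lim by eventually_elim (auto simp: N_def)
  qed
qed

lemma enn2real_ge_1: "1 \<le> p \<Longrightarrow> p \<noteq> \<infinity> \<Longrightarrow> 1 \<le> enn2real p"
  by (metis enn2real_1 enn2real_mono infinity_ennreal_def top.not_eq_extremum)

text \<open>For \<open>p = \<infinity>\<close> the essential supremum is itself an almost everywhere
  bound. For finite \<open>p\<close> a finite integral of a nonnegative measurable function gives
  integrability, and taking \<open>P\<close>-th roots preserves inequalities between nonnegative
  numbers.\<close>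

lemma (in complete_measure) Lp_bounded_iff:
  assumes p: "1 \<le> p" and c: "0 \<le> c"
  shows "Lp_bounded p M c f \<longleftrightarrow> f \<in> Lp_space p M \<and> Lp_norm p M f \<le> c"
proof (cases "strongly_measurable M f")
  case True
  note [measurable] = borel_measurable_norm_strongly_measurable[OF True]
  show ?thesis
  proof (cases "p = \<infinity>")
    case p: True
    let ?e = "esssup M (\<lambda>x. ennreal (norm (f x)))"
    have "(AE x in M. norm (f x) \<le> c) \<longleftrightarrow> ?e \<le> ennreal c"
    proof
      assume "AE x in M. norm (f x) \<le> c"
      then show "?e \<le> ennreal c"
        by (intro esssup_I) (auto elim!: eventually_mono intro: ennreal_leI)
    next
      assume e: "?e \<le> ennreal c"
      show "AE x in M. norm (f x) \<le> c"
        using esssup_AE[where f = "\<lambda>x. ennreal (norm (f x))" and M = M]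
      proof eventually_elim
        case (elim x)
        then show ?case using e c by (metis ennreal_le_iff order_trans)
      qed
    qed
    also have "\<dots> \<longleftrightarrow> ?e < \<infinity> \<and> enn2real ?e \<le> c"
      using c by (cases ?e) (auto simp: top_unique)
    finally show ?thesis
      using True p by (simp add: Lp_bounded_def Lp_space_def Lp_norm_def)
  next
    case False
    define P where "P = enn2real p"
    have P: "1 \<le> P" unfolding P_def using p False by (rule enn2real_ge_1)
    define g where "g = (\<lambda>x. norm (f x) powr P)"
    have g[measurable]: "g \<in> borel_measurable M" unfolding g_def by measurable
    have g0: "0 \<le> g x" for x by (simp add: g_def)
    have "(\<integral>\<^sup>+x. ennreal (g x) \<partial>M) \<le> ennreal (c powr P) \<longleftrightarrow>
        integrable M g \<and> integral\<^sup>L M g \<le> c powr P" (is "?L \<longleftrightarrow> ?R")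
    proof
      assume L: ?L
      then have "integrable M g"
        by (intro integrableI_nonneg) (auto simp: g0 intro: le_less_trans)
      with L show ?R
        by (simp add: nn_integral_eq_integral g0)
    next
      assume ?R
      then show ?L by (simp add: nn_integral_eq_integral g0 ennreal_leI)
    qed
    also have "integral\<^sup>L M g \<le> c powr P \<longleftrightarrow> integral\<^sup>L M g powr (1 / P) \<le> c"
    proof -
      have I: "0 \<le> integral\<^sup>L M g" by (simp add: g0)
      have "(integral\<^sup>L M g powr (1 / P)) powr P = integral\<^sup>L M g"
        "(c powr P) powr (1 / P) = c"
        using I P c by (simp_all add: powr_powr)
      then show ?thesis
        using I P powr_mono2[of P "integral\<^sup>L M g powr (1 / P)" c]
          powr_mono2[of "1 / P" "integral\<^sup>L M g" "c powr P"]
        by auto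
    qed
    finally show ?thesis
      using True False by (simp add: Lp_bounded_def Lp_space_def Lp_norm_def g_def P_def)
  qed
next
  case False
  then show ?thesis by (simp add: Lp_bounded_def Lp_space_def)
qed

lemma Lp_norm_nonneg: "0 \<le> Lp_norm p M f"
  by (simp add: Lp_norm_def)

text \<open>Simple functions stay simple on the smaller set, and passing to it cannot increase the
  norm. The freedom to change \<open>f\<close> off \<open>S\<close> allows a control to be redefined
  at negative times.\<close>

lemma Lp_bounded_restrict_space:
  assumes f: "Lp_bounded p M c f" and S: "S \<inter> space M \<in> sets M"
    and eq: "\<And>x. x \<in> S \<inter> space M \<Longrightarrow> g x = f x"
  shows "Lp_bounded p (restrict_space M S) c g"
proof -
  obtain s where s: "\<And>n::nat. simple_function M (s n)"
    and lim: "AE x in M. (\<lambda>n. s n x) \<longlonglongrightarrow> f x"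
    using f unfolding Lp_bounded_def strongly_measurable_def by blast
  have lim': "AE x in restrict_space M S. (\<lambda>n. s n x) \<longlonglongrightarrow> g x"
    unfolding AE_restrict_space_iff[OF S] using lim AE_space
    by eventually_elim (simp add: eq)
  have s': "simple_function (restrict_space M S) (s n)" for n
    unfolding simple_function_def
  proof (intro conjI ballI)
    have "s n ` space (restrict_space M S) \<subseteq> s n ` space M"
      by (auto simp: space_restrict_space)
    then show "finite (s n ` space (restrict_space M S))"
      using simple_functionD(1)[OF s] by (rule finite_subset)
    fix y
    have "s n -` {y} \<inter> space M \<in> sets M" by (rule simple_functionD(2)[OF s])
    then have "(S \<inter> space M) \<inter> (s n -` {y} \<inter> space M) \<in> sets M" using S by blast
    then show "s n -` {y} \<inter> space (restrict_space M S) \<in> sets (restrict_space M S)"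
      by (simp add: sets_restrict_space_iff S space_restrict_space Int_ac)
  qed
  have "strongly_measurable (restrict_space M S) g"
    unfolding strongly_measurable_def using s' lim' by blast
  moreover have "AE x in restrict_space M S. norm (g x) \<le> c" if "p = \<infinity>"
  proof -
    have "AE x in M. norm (f x) \<le> c" using f that by (simp add: Lp_bounded_def)
    then show ?thesis
      unfolding AE_restrict_space_iff[OF S] using AE_space by eventually_elim (simp add: eq)
  qed
  moreover have "(\<integral>\<^sup>+x. ennreal (norm (g x) powr enn2real p) \<partial>restrict_space M S)
      \<le> ennreal (c powr enn2real p)" if "p \<noteq> \<infinity>"
  proof -
    have "(\<integral>\<^sup>+x. ennreal (norm (g x) powr enn2real p) \<partial>restrict_space M S)
        = (\<integral>\<^sup>+x. ennreal (norm (g x) powr enn2real p) * indicator S x \<partial>M)"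
      by (rule nn_integral_restrict_space[OF S])
    also have "\<dots> \<le> (\<integral>\<^sup>+x. ennreal (norm (f x) powr enn2real p) \<partial>M)"
      by (intro nn_integral_mono) (auto simp: eq split: split_indicator)
    also have "\<dots> \<le> ennreal (c powr enn2real p)"
      using f that by (simp add: Lp_bounded_def)
    finally show ?thesis .
  qed
  ultimately show ?thesis by (simp add: Lp_bounded_def)
qed

text \<open>Multiplication by the indicator of \<open>S\<close> makes the approximants simple on all
  of \<open>M\<close>, and the integral is unchanged. For \<open>p = \<infinity>\<close> the sign of
  \<open>c\<close> gives the bound off \<open>S\<close>.\<close>

lemma Lp_bounded_extend_by_zero:
  assumes f: "Lp_bounded p (restrict_space M S) c f" and S: "S \<inter> space M \<in> sets M"
    and c: "0 \<le> c"
    and g: "\<And>x. x \<in> S \<Longrightarrow> g x = f x" "\<And>x. x \<notin> S \<Longrightarrow> g x = 0"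
  shows "Lp_bounded p M c g"
proof -
  obtain s where s: "\<And>n::nat. simple_function (restrict_space M S) (s n)"
    and lim: "AE x in restrict_space M S. (\<lambda>n. s n x) \<longlonglongrightarrow> f x"
    using f unfolding Lp_bounded_def strongly_measurable_def by blast
  have "AE x in M. (\<lambda>n. indicator S x *\<^sub>R s n x) \<longlonglongrightarrow> g x"
    using lim unfolding AE_restrict_space_iff[OF S]
    by eventually_elim (auto simp: g split: split_indicator)
  then have "strongly_measurable M g"
    unfolding strongly_measurable_def
    using s[unfolded simple_function_restrict_space[OF S]]
    by (intro exI[of _ "\<lambda>n x. indicator S x *\<^sub>R s n x"]) simp
  moreover have "AE x in M. norm (g x) \<le> c" if "p = \<infinity>"
  proof -
    have "AE x in restrict_space M S. norm (f x) \<le> c" using f that by (simp add: Lp_bounded_def)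
    then show ?thesis
      unfolding AE_restrict_space_iff[OF S]
    proof eventually_elim
      case (elim x)
      then show ?case using c by (cases "x \<in> S") (auto simp: g)
    qed
  qed
  moreover have "(\<integral>\<^sup>+x. ennreal (norm (g x) powr enn2real p) \<partial>M) \<le> ennreal (c powr enn2real p)"
    if "p \<noteq> \<infinity>"
  proof -
    have "(\<integral>\<^sup>+x. ennreal (norm (g x) powr enn2real p) \<partial>M)
        = (\<integral>\<^sup>+x. ennreal (norm (f x) powr enn2real p) * indicator S x \<partial>M)"
      by (intro nn_integral_cong) (auto simp: g split: split_indicator)
    also have "\<dots> = (\<integral>\<^sup>+x. ennreal (norm (f x) powr enn2real p) \<partial>restrict_space M S)"
      by (rule nn_integral_restrict_space[OF S, symmetric])
    finally show ?thesis using f that by (simp add: Lp_bounded_def)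
  qed
  ultimately show ?thesis by (simp add: Lp_bounded_def)
qed

text \<open>Since the image measure under \<open>\<phi>\<close> is \<open>M\<close> again, almost
  everywhere statements pull back along \<open>\<phi>\<close> and integrals are preserved.\<close>

lemma (in complete_measure) Lp_bounded_measure_preserving:
  assumes f: "Lp_bounded p M c f" and \<phi>: "\<phi> \<in> measurable M M" and d: "distr M M \<phi> = M"
  shows "Lp_bounded p M c (\<lambda>x. f (\<phi> x))"
proof -
  have AE: "AE x in M. Q (\<phi> x)" if "AE x in M. Q x" for Q
    using AE_distrD[OF \<phi>, of Q] that unfolding d by blast
  obtain s where s: "\<And>n::nat. simple_function M (s n)"
    and lim: "AE x in M. (\<lambda>n. s n x) \<longlonglongrightarrow> f x"
    using f unfolding Lp_bounded_def strongly_measurable_def by blast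
  have "strongly_measurable M (\<lambda>x. f (\<phi> x))"
    unfolding strongly_measurable_def
    using simple_function_comp[OF \<phi> s] AE[OF lim]
    by (intro exI[of _ "\<lambda>n x. s n (\<phi> x)"]) auto
  moreover have "(\<integral>\<^sup>+x. ennreal (norm (f (\<phi> x)) powr enn2real p) \<partial>M) =
      (\<integral>\<^sup>+x. ennreal (norm (f x) powr enn2real p) \<partial>M)"
  proof -
    have [measurable]: "(\<lambda>x. norm (f x)) \<in> borel_measurable M"
      using f borel_measurable_norm_strongly_measurable by (auto simp: Lp_bounded_def)
    have "(\<lambda>x. ennreal (norm (f x) powr enn2real p)) \<in> borel_measurable M"
      by measurable
    then show ?thesis
      using nn_integral_distr[OF \<phi>, of "\<lambda>x. ennreal (norm (f x) powr enn2real p)"] by (simp add: d)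
  qed
  ultimately show ?thesis
    using f AE[of "\<lambda>x. norm (f x) \<le> c"] by (auto simp: Lp_bounded_def)
qed

section \<open>Completeness and translation invariance of Lebesgue measure\<close>

lemma complete_measure_lebesgue: "complete_measure (lebesgue :: 'a::euclidean_space measure)"
  by (rule completion.complete_measure_axioms)

lemma complete_measure_lebesgue_on:
  assumes S: "S \<in> sets lebesgue"
  shows "complete_measure (lebesgue_on S)"
proof
  fix A B :: "'a set" assume "B \<subseteq> A" "A \<in> null_sets (lebesgue_on S)"
  then have "A \<in> null_sets lebesgue" "A \<subseteq> S"
    using S by (auto simp: null_sets_restrict_space)
  with \<open>B \<subseteq> A\<close> have "B \<in> sets lebesgue" "B \<subseteq> S"
    by (auto intro: completion.complete)
  then show "B \<in> sets (lebesgue_on S)"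
    using S by (simp add: sets_restrict_space_iff)
qed

lemmas Lp_bounded_lebesgue_on_iff =
  complete_measure.Lp_bounded_iff[OF complete_measure_lebesgue_on]

text \<open>Controls are shifted on the whole line, where translations preserve the measure, and are
  cut down to the half-line or to a finite horizon only afterwards.\<close>

lemma Lp_bounded_shift:
  fixes f :: "real \<Rightarrow> 'b::banach"
  assumes "Lp_bounded p lebesgue c f"
  shows "Lp_bounded p lebesgue c (\<lambda>x. f (t + x))"
proof (rule complete_measure.Lp_bounded_measure_preserving[OF complete_measure_lebesgue assms])
  show "(\<lambda>x. t + x) \<in> lebesgue \<rightarrow>\<^sub>M lebesgue"
    using lebesgue_affine_measurable[of "\<lambda>_. 1::real" t] by simp
  show "distr lebesgue lebesgue (\<lambda>x. t + x) = lebesgue"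
    using lebesgue_real_affine[of 1 t] by (simp add: density_1)
qed

section \<open>Gluing countably many functions\<close>

text \<open>This is the norm-one inclusion of the sequence space l^1 in l^P. It bounds the
  \<open>P\<close>-th powers of the norms of disjoint pieces by the sum of the norms.\<close>

lemma suminf_powr_le:
  fixes a :: "nat \<Rightarrow> real"
  assumes a: "\<And>k. 0 \<le> a k" "summable a" and P: "1 \<le> P"
  shows "(\<Sum>k. ennreal (a k powr P)) \<le> ennreal ((\<Sum>k. a k) powr P)"
proof -
  define S where "S = (\<Sum>k. a k)"
  have S: "0 \<le> S" unfolding S_def using a by (simp add: suminf_nonneg)
  \<comment> \<open>Since \<open>a k \<le> S\<close>, it suffices to replace all but one factor \<open>a k\<close> by \<open>S\<close>.\<close>
  have le: "a k powr P \<le> a k * S powr (P - 1)" for k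
  proof -
    have "a k \<le> S"
      using sum_le_suminf[OF a(2), of "{k}"] a(1) by (simp add: S_def)
    then have "a k powr (P - 1) \<le> S powr (P - 1)"
      using a(1) P by (intro powr_mono2) auto
    then have "a k * a k powr (P - 1) \<le> a k * S powr (P - 1)"
      using a(1) by (rule mult_left_mono)
    then show ?thesis using a(1)[of k] P by (simp add: powr_mult_base)
  qed
  have "(\<Sum>k. ennreal (a k powr P)) \<le> (\<Sum>k. ennreal (a k * S powr (P - 1)))"
    using le by (intro suminf_le) (auto intro: ennreal_leI)
  also have "\<dots> = ennreal (\<Sum>k. a k * S powr (P - 1))"
    using a by (intro suminf_ennreal2) (auto intro: summable_mult2)
  also have "(\<Sum>k. a k * S powr (P - 1)) = S * S powr (P - 1)"
    using suminf_mult2[OF a(2), of "S powr (P - 1)"] by (simp add: S_def)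
  also have "\<dots> = S powr P"
    using S P by (simp add: powr_mult_base)
  finally show ?thesis by (simp add: S_def)
qed

text \<open>At each point at most one piece is active, so the norm of \<open>f\<close>, or its
  power, is dominated by the corresponding series over all pieces. The sum of the norms is a crude
  bound, but it serves every \<open>p\<close> at once.\<close>

lemma (in complete_measure) Lp_bounded_glue:
  assumes p: "1 \<le> p" and A: "disjoint_family A" "\<And>k. A k \<in> sets M"
    and a: "\<And>k. 0 \<le> a k" "summable a"
    and g: "\<And>k::nat. Lp_bounded p M (a k) (g k)"
    and f: "\<And>k x. x \<in> A k \<Longrightarrow> f x = g k x" "\<And>x. x \<notin> (\<Union>k. A k) \<Longrightarrow> f x = 0"
  shows "Lp_bounded p M (\<Sum>k. a k) f"
proof -
  have "\<exists>s. (\<forall>n::nat. simple_function M (s n)) \<and> (AE x in M. (\<lambda>n. s n x) \<longlonglongrightarrow> g k x)" for k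
    using g[of k] unfolding Lp_bounded_def strongly_measurable_def by blast
  then obtain s where s: "\<And>k n::nat. simple_function M (s k n)"
    and lim: "\<And>k. AE x in M. (\<lambda>n. s k n x) \<longlonglongrightarrow> g k x"
    by metis
  \<comment> \<open>Only the first \<open>n\<close> pieces enter, which keeps \<open>h n\<close>
    simple. At a point of \<open>A k\<close> the sum reduces to \<open>s k n x\<close> as soon as
    \<open>k < n\<close>.\<close>
  define h where "h n x = (\<Sum>k<n. indicat_real (A k) x *\<^sub>R s k n x)" for n x
  have "simple_function M (h n)" for n
    unfolding h_def
    by (rule simple_function_sum, rule simple_function_scaleR[OF simple_function_indicator[OF A(2)] s])
  moreover have "AE x in M. (\<lambda>n. h n x) \<longlonglongrightarrow> f x"
  proof -
    have "AE x in M. \<forall>k. (\<lambda>n. s k n x) \<longlonglongrightarrow> g k x"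
      using lim by (simp add: AE_all_countable)
    then show ?thesis
    proof eventually_elim
      case (elim x)
      show ?case
      proof (cases "x \<in> (\<Union>k. A k)")
        case True
        then obtain k where k: "x \<in> A k" by blast
        have ind: "indicat_real (A j) x = (if j = k then 1 else 0)" for j
          using A(1) k by (auto simp: disjoint_family_on_def split: split_indicator)
        have "h n x = s k n x" if "k < n" for n
        proof -
          have "h n x = (\<Sum>j<n. if k = j then s j n x else 0)"
            unfolding h_def ind by (intro sum.cong) auto
          then show ?thesis using that by simp
        qed
        then have "\<forall>\<^sub>F n in sequentially. s k n x = h n x"
          by (intro eventually_mono[OF eventually_gt_at_top[of k]]) simp
        then show ?thesis
          unfolding f(1)[OF k] by (rule Lim_transform_eventually[OF elim[rule_format]])
      next
        case False
        then have "h n x = 0" for n by (auto simp: h_def)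
        then show ?thesis using f(2)[OF False] by simp
      qed
    qed
  qed
  ultimately have "strongly_measurable M f"
    unfolding strongly_measurable_def by (intro exI[of _ h]) simp
  moreover have "AE x in M. norm (f x) \<le> (\<Sum>k. a k)" if "p = \<infinity>"
  proof -
    have "AE x in M. \<forall>k. norm (g k x) \<le> a k"
      using g that by (simp add: AE_all_countable Lp_bounded_def)
    then show ?thesis
    proof eventually_elim
      case (elim x)
      show ?case
      proof (cases "x \<in> (\<Union>k. A k)")
        case True
        then obtain k where k: "x \<in> A k" by blast
        have "a k \<le> (\<Sum>k. a k)"
          using sum_le_suminf[OF a(2), of "{k}"] a(1) by simp
        then show ?thesis using elim[rule_format, of k] f(1)[OF k] by simp
      next
        case False
        then show ?thesis using f(2) a by (simp add: suminf_nonneg)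
      qed
    qed
  qed
  moreover have "(\<integral>\<^sup>+x. ennreal (norm (f x) powr enn2real p) \<partial>M)
      \<le> ennreal ((\<Sum>k. a k) powr enn2real p)" if "p \<noteq> \<infinity>"
  proof -
    let ?P = "enn2real p"
    have [measurable]: "(\<lambda>x. norm (g k x)) \<in> borel_measurable M" for k
      using g[of k] borel_measurable_norm_strongly_measurable by (auto simp: Lp_bounded_def)
    have "(\<integral>\<^sup>+x. ennreal (norm (f x) powr ?P) \<partial>M)
        \<le> (\<integral>\<^sup>+x. (\<Sum>k. ennreal (norm (g k x) powr ?P)) \<partial>M)"
    proof (rule nn_integral_mono)
      fix x
      show "ennreal (norm (f x) powr ?P) \<le> (\<Sum>k. ennreal (norm (g k x) powr ?P))"
      proof (cases "x \<in> (\<Union>k. A k)")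
        case True
        then obtain k where k: "x \<in> A k" by blast
        have "(\<Sum>j\<in>{k}. ennreal (norm (g j x) powr ?P)) \<le> (\<Sum>j. ennreal (norm (g j x) powr ?P))"
          by (rule sum_le_suminf) auto
        then show ?thesis unfolding f(1)[OF k] by simp
      next
        case False
        then show ?thesis using f(2) by simp
      qed
    qed
    also have "\<dots> = (\<Sum>k. \<integral>\<^sup>+x. ennreal (norm (g k x) powr ?P) \<partial>M)"
      by (rule nn_integral_suminf) measurable
    also have "\<dots> \<le> (\<Sum>k. ennreal (a k powr ?P))"
      using g that by (intro suminf_le) (auto simp: Lp_bounded_def)
    also have "\<dots> \<le> ennreal ((\<Sum>k. a k) powr ?P)"
      using a enn2real_ge_1[OF p that] by (intro suminf_powr_le) auto
    finally show ?thesis .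
  qed
  ultimately show ?thesis by (simp add: Lp_bounded_def)
qed

section \<open>Concatenating infinitely many controls\<close>

text \<open>Gluing the shifted controls gives one control in \<open>Lp_space\<close>. By the
  composition law its trajectory passes through \<open>y k\<close> at the \<open>k\<close>-th
  switching time, and continuity at \<open>T\<close> identifies the final state with the
  limit.\<close>

lemma concatenate_infinitely_many_controls:
  fixes F :: "real \<Rightarrow> 'y::banach \<times> (real \<Rightarrow> 'u::banach) \<Rightarrow> 'y"
  assumes p: "1 \<le> p" and F: "control_flow p F"
    and \<tau>: "\<And>k. 0 < \<tau> k" "\<tau> sums T"
    and a: "\<And>k. 0 \<le> a k" "summable a"
    and u: "\<And>k. u k \<in> Lp_space p (horizon (\<tau> k))" "\<And>k. Lp_norm p (horizon (\<tau> k)) (u k) \<le> a k"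
    and y: "\<And>k. y (Suc k) = F (\<tau> k) (y k, zero_extension (\<tau> k) (u k))" "y \<longlonglongrightarrow> l"
  shows "\<exists>v\<in>Lp_space p (horizon T). Lp_norm p (horizon T) v \<le> suminf a \<and>
    F T (y 0, zero_extension T v) = l"
proof -
  define t where "t k = sum \<tau> {..<k}" for k
  have t_Suc: "t (Suc k) = t k + \<tau> k" for k by (simp add: t_def)
  have t_0 [simp]: "t 0 = 0" by (simp add: t_def)
  have t_lim: "t \<longlonglongrightarrow> T" using \<tau>(2) unfolding sums_def t_def .
  have t_strict: "strict_mono t"
    using \<tau>(1) by (intro strict_monoI_Suc) (simp add: t_Suc)
  have t_mono: "i \<le> j \<Longrightarrow> t i \<le> t j" for i j
    using t_strict by (simp add: strict_mono_less_eq)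
  have t_nonneg: "0 \<le> t k" for k using t_mono[of 0 k] by simp
  have t_less: "t k < T" for k
    using sum_less_suminf[of \<tau> k] \<tau> by (simp add: t_def sums_iff)
  have T: "0 < T" using t_less[of 0] by simp
  define A where "A k = {t k..<t (Suc k)}" for k
  have A_unique: "i = j" if "x \<in> A i" "x \<in> A j" for x i j
  proof (rule ccontr)
    assume "i \<noteq> j"
    then have "Suc i \<le> j \<or> Suc j \<le> i" by auto
    with t_mono[of "Suc i" j] t_mono[of "Suc j" i] that show False by (auto simp: A_def)
  qed
  define w where "w k = zero_extension (\<tau> k) (u k)" for k
  \<comment> \<open>The index is unique because the intervals are disjoint. The default 0 covers
    negative times and times from \<open>T\<close> on.\<close>
  define U where "U x = (if \<exists>k. x \<in> A k then w (THE k. x \<in> A k) (x - t (THE k. x \<in> A k)) else 0)" for x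
  have U_A: "U x = w k (x - t k)" if "x \<in> A k" for x k
  proof -
    have "(THE k. x \<in> A k) = k" using that A_unique by blast
    then show ?thesis using that by (auto simp: U_def)
  qed
  \<comment> \<open>The time 0 belongs to \<open>A 0\<close>, but each \<open>w k\<close> is
    supported in an open interval and vanishes at local time 0. Hence \<open>U\<close> will equal
    its own zero extension.\<close>
  have U_0: "U x = 0" if "x \<notin> {0<..<T}" for x
  proof (cases "\<exists>k. x \<in> A k")
    case True
    then obtain k where k: "x \<in> A k" by blast
    then have "x < T" "t k \<le> x" using t_less[of "Suc k"] by (auto simp: A_def)
    with that t_nonneg[of k] have "x - t k = 0" by auto
    then show ?thesis using U_A[OF k] by (simp add: w_def zero_extension_def)
  qed (simp add: U_def)

  have w_Lp: "Lp_bounded p lebesgue (a k) (w k)" for k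
  proof (rule Lp_bounded_extend_by_zero)
    show "Lp_bounded p (horizon (\<tau> k)) (a k) (u k)"
      using u Lp_bounded_lebesgue_on_iff[OF _ p a(1), of "{0<..<\<tau> k}" k "u k"] by simp
  qed (use a in \<open>auto simp: w_def zero_extension_def\<close>)
  have U_Lp: "Lp_bounded p lebesgue (suminf a) U"
  proof (rule complete_measure.Lp_bounded_glue[OF complete_measure_lebesgue p _ _ a])
    show "disjoint_family A"
      using A_unique by (auto simp: disjoint_family_on_def)
    show "A k \<in> sets lebesgue" for k
      by (auto simp: A_def)
    show "Lp_bounded p lebesgue (a k) (\<lambda>x. w k (- t k + x))" for k
      by (rule Lp_bounded_shift[OF w_Lp])
    show "U x = w k (- t k + x)" if "x \<in> A k" for k x
      using U_A[OF that] by (simp add: algebra_simps)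
    show "U x = 0" if "x \<notin> (\<Union>k. A k)" for x
      using that by (auto simp: U_def)
  qed
  have a_sum: "0 \<le> suminf a" using a by (simp add: suminf_nonneg)
  have half_line_Lp: "f \<in> Lp_space p half_line"
    if "Lp_bounded p lebesgue c g" "0 \<le> c" "\<And>x. 0 \<le> x \<Longrightarrow> f x = g x"
    for c and f g :: "real \<Rightarrow> 'u"
    using Lp_bounded_lebesgue_on_iff[OF _ p that(2), of "{0..}" f]
      Lp_bounded_restrict_space[OF that(1), of "{0..}" f] that(3) by auto

  \<comment> \<open>The value \<open>0\<close> on the negative axis makes the concatenation identity below hold everywhere.\<close>
  define V where "V k x = (if x < 0 then 0 else U (t k + x))" for k x
  have U_half: "U \<in> Lp_space p half_line"
    by (rule half_line_Lp[OF U_Lp a_sum]) simp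
  have V_half: "V k \<in> Lp_space p half_line" for k
    by (rule half_line_Lp[OF Lp_bounded_shift[OF U_Lp, of "t k"] a_sum]) (simp add: V_def)
  have w_half: "w k \<in> Lp_space p half_line" for k
    by (rule half_line_Lp[OF w_Lp a(1)]) simp
  have V_step: "V k = concatenation (\<tau> k) (w k) (V (Suc k))" for k
  proof
    fix x
    show "V k x = concatenation (\<tau> k) (w k) (V (Suc k)) x"
    proof (cases "0 \<le> x \<and> x < \<tau> k")
      case True
      then have "t k + x \<in> A k" by (simp add: A_def t_Suc)
      then show ?thesis using True U_A by (simp add: V_def concatenation_def)
    next
      case False
      then show ?thesis
        using \<tau>(1)[of k]
        by (auto simp: V_def concatenation_def w_def zero_extension_def t_Suc algebra_simps)
    qed
  qed
  \<comment> \<open>The first argument can be \<open>U\<close> itself, since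
    \<open>concatenation\<close> reads it only before \<open>t k\<close>.\<close>
  have U_split: "U = concatenation (t k) U (V k)" for k
    by (auto simp: V_def concatenation_def)

  have F_comp: "F (r + s) (z, concatenation s f g) = F r (F s (z, f), g)"
    if "0 \<le> r" "0 \<le> s" "f \<in> Lp_space p half_line" "g \<in> Lp_space p half_line" for r s z f g
    using F that unfolding control_flow_def by blast
  have F_cont: "continuous_on {0..} (\<lambda>s. F s (z, f))" and F_0: "F 0 (z, f) = z"
    if "f \<in> Lp_space p half_line" for z f
    using F that unfolding control_flow_def by blast+
  have y_U: "F (t k) (y 0, U) = y k" for k
  proof (induction k)
    case 0
    show ?case by (simp add: F_0[OF U_half])
  next
    case (Suc k)
    have "F (\<tau> k + t k) (y 0, concatenation (t k) U (V k)) = F (\<tau> k) (F (t k) (y 0, U), V k)"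
      using \<tau>(1)[of k] t_nonneg[of k] by (intro F_comp U_half V_half) auto
    \<comment> \<open>Writing the duration as \<open>0 + \<tau> k\<close> lets the composition law
      split off the tail \<open>V (Suc k)\<close>, which then acts for time 0 and leaves the state
      unchanged.\<close>
    also have "\<dots> = F (0 + \<tau> k) (y k, concatenation (\<tau> k) (w k) (V (Suc k)))"
      by (simp add: Suc.IH flip: V_step)
    also have "\<dots> = F 0 (F (\<tau> k) (y k, w k), V (Suc k))"
      using \<tau>(1)[of k] by (intro F_comp w_half V_half) auto
    also have "\<dots> = y (Suc k)"
      by (simp add: F_0[OF V_half] y(1) w_def)
    finally show ?case
      by (simp add: t_Suc add.commute flip: U_split)
  qed
  have "(\<lambda>k. F (t k) (y 0, U)) \<longlonglongrightarrow> F T (y 0, U)"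
    using continuous_on_tendsto_compose[OF F_cont[OF U_half] t_lim] T t_nonneg by simp
  then have "F T (y 0, U) = l"
    unfolding y_U using y(2) by (rule LIMSEQ_unique)
  moreover have "zero_extension T U = U"
    using U_0 by (auto simp: zero_extension_def)
  moreover have "Lp_bounded p (horizon T) (suminf a) U"
    by (rule Lp_bounded_restrict_space[OF U_Lp]) auto
  then have "U \<in> Lp_space p (horizon T)" "Lp_norm p (horizon T) U \<le> suminf a"
    using Lp_bounded_lebesgue_on_iff[OF _ p a_sum, of "{0<..<T}" U] by simp_all
  ultimately show ?thesis by (intro bexI[of _ U]) simp_all
qed

section \<open>The choice of time steps and the decay of the states\<close>

text \<open>Steering in time \<open>\<tau> k\<close> costs the exponential of a multiple of
  \<open>\<tau> k powr (- \<sigma>)\<close>. The steps must therefore shrink slowly enough to keep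
  this exponent at growth rate \<open>q\<close>, yet fill exactly the time \<open>T\<close>.\<close>

lemma geometric_time_steps:
  fixes T q \<sigma> :: real
  assumes T: "0 < T" and q: "1 < q" and \<sigma>: "0 < \<sigma>"
  obtains \<tau> A where "\<And>k. 0 < \<tau> k" "\<tau> sums T" "0 < A" "\<And>k::nat. \<tau> k powr (- \<sigma>) = A * q ^ k"
proof
  \<comment> \<open>The ratio solves \<open>r powr (- \<sigma>) = q\<close>; the factor
    \<open>1 - r\<close> below normalises the total length to \<open>T\<close>.\<close>
  define r where "r = q powr (- 1 / \<sigma>)"
  have r: "0 < r" "r < 1"
    using q \<sigma> by (auto simp: r_def powr_less_one)
  show "0 < T * (1 - r) * r ^ k" for k using T r by simp
  have "(\<lambda>k. T * (1 - r) * r ^ k) sums (T * (1 - r) * (1 / (1 - r)))"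
    using r by (intro sums_mult geometric_sums) auto
  then show "(\<lambda>k. T * (1 - r) * r ^ k) sums T" using r by simp
  show "0 < (T * (1 - r)) powr (- \<sigma>)" using T r by simp
  show "(T * (1 - r) * r ^ k) powr (- \<sigma>) = (T * (1 - r)) powr (- \<sigma>) * q ^ k" for k
  proof -
    have "(r ^ k) powr (- \<sigma>) = (r powr (- \<sigma>)) ^ k"
      using r by (simp add: powr_powr mult.commute flip: powr_realpow)
    also have "r powr (- \<sigma>) = q"
      using q \<sigma> by (simp add: r_def powr_powr)
    finally show ?thesis using T r by (simp add: powr_mult)
  qed
qed

text \<open>Here \<open>x\<close> is the norm of the state, \<open>v\<close> that of the control,
  and \<open>Q\<close> stands for \<open>q ^ k\<close>. After the power \<open>\<gamma>\<close> is
  taken, exponents are compared separately: the terms in \<open>Q\<close> by the condition on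
  \<open>\<beta>\<close>, the constants by that on \<open>D\<close>. For \<open>q < \<gamma>\<close>
  both conditions hold once \<open>\<beta>\<close> and \<open>D\<close> are large.\<close>

lemma superexponential_decay_step:
  fixes x v \<alpha> \<beta> C\<^sub>L C\<^sub>N \<gamma> q D Q :: real
  assumes x: "0 \<le> x" "x \<le> exp (- \<beta> * Q - D)"
    and v: "0 \<le> v" "v \<le> C\<^sub>L * exp (\<alpha> * Q) * x"
    and pos: "0 < C\<^sub>L" "0 < C\<^sub>N" "0 \<le> \<alpha>" "0 \<le> Q" "1 < \<gamma>"
    and \<beta>: "\<gamma> * \<alpha> \<le> \<beta> * (\<gamma> - q)"
    and D: "ln (C\<^sub>N * (1 + C\<^sub>L) powr \<gamma>) \<le> (\<gamma> - 1) * D"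
  shows "C\<^sub>N * (x + v) powr \<gamma> \<le> exp (- \<beta> * (q * Q) - D)"
proof -
  \<comment> \<open>The cost factor is at least 1, so state and control fit under one bound with
    constant \<open>1 + C\<^sub>L\<close>.\<close>
  have "x \<le> exp (\<alpha> * Q) * x"
    using x pos mult_right_mono[of 1 "exp (\<alpha> * Q)" x] by simp
  then have "x + v \<le> (1 + C\<^sub>L) * exp (\<alpha> * Q) * x"
    using v by (simp add: algebra_simps)
  also have "\<dots> \<le> (1 + C\<^sub>L) * exp (\<alpha> * Q) * exp (- \<beta> * Q - D)"
    using x pos by (intro mult_left_mono) auto
  finally have "(x + v) powr \<gamma> \<le> ((1 + C\<^sub>L) * exp (\<alpha> * Q) * exp (- \<beta> * Q - D)) powr \<gamma>"
    using x v pos by (intro powr_mono2) auto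
  also have "\<dots> = (1 + C\<^sub>L) powr \<gamma> * exp (\<gamma> * (\<alpha> * Q - \<beta> * Q - D))"
  proof -
    have "((1 + C\<^sub>L) * exp (\<alpha> * Q) * exp (- \<beta> * Q - D)) powr \<gamma>
        = ((1 + C\<^sub>L) * exp (\<alpha> * Q - \<beta> * Q - D)) powr \<gamma>"
      by (simp add: mult.assoc add_diff_eq flip: exp_add)
    also have "\<dots> = (1 + C\<^sub>L) powr \<gamma> * exp ((\<alpha> * Q - \<beta> * Q - D) * \<gamma>)"
      using pos by (simp add: powr_mult exp_powr_real)
    finally show ?thesis by (simp add: mult.commute)
  qed
  finally have "C\<^sub>N * (x + v) powr \<gamma> \<le> C\<^sub>N * ((1 + C\<^sub>L) powr \<gamma> * exp (\<gamma> * (\<alpha> * Q - \<beta> * Q - D)))"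
    using pos by (intro mult_left_mono) auto
  also have "\<dots> = exp (ln (C\<^sub>N * (1 + C\<^sub>L) powr \<gamma>) + \<gamma> * (\<alpha> * Q - \<beta> * Q - D))"
    using pos by (simp add: exp_add)
  also have "\<dots> \<le> exp (- \<beta> * (q * Q) - D)"
  proof -
    have "\<gamma> * \<alpha> * Q \<le> \<beta> * (\<gamma> - q) * Q"
      using \<beta> pos by (intro mult_right_mono) auto
    then show ?thesis using D by (simp add: algebra_simps)
  qed
  finally show ?thesis .
qed

text \<open>Bernoulli's inequality replaces the superexponential decay by a geometric one, whose sum
  is explicit.\<close>

lemma exp_neg_power_le:
  fixes q :: real
  assumes "1 < q"
  shows "exp (- (q ^ k)) \<le> exp (- (q - 1)) ^ k"
proof -
  have "1 + real k * (q - 1) \<le> q ^ k"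
    using Bernoulli_inequality[of "q - 1" k] assms by simp
  then have "- (q ^ k) \<le> real k * - (q - 1)"
    by (simp add: algebra_simps)
  then show ?thesis by (simp flip: exp_of_nat_mult)
qed

text \<open>\<open>K r z\<close> stands for a control steering the linear system from
  \<open>z\<close> to 0 in time \<open>r\<close>. The linear system then enters only through the
  cost bound and the bound on the nonlinear end state, which is the linearization error.\<close>

lemma null_control_with_small_norm:
  fixes \<S> :: "real \<Rightarrow> 'y::banach \<times> (real \<Rightarrow> 'u::banach) \<Rightarrow> 'y"
  assumes p: "1 \<le> p" and flow: "control_flow p \<S>"
    and pos: "0 < \<sigma>" "0 < c" "0 < C\<^sub>L" "1 < \<gamma>" "0 < C\<^sub>N" "0 < T" "0 < \<eta>"
    and K: "\<And>r z. 0 < r \<Longrightarrow> K r z \<in> Lp_space p (horizon r)"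
      "\<And>r z. 0 < r \<Longrightarrow> Lp_norm p (horizon r) (K r z) \<le> C\<^sub>L * exp (c * r powr (- \<sigma>)) * norm z"
      "\<And>r z. 0 < r \<Longrightarrow> norm (\<S> r (z, zero_extension r (K r z)))
         \<le> C\<^sub>N * (norm z + Lp_norm p (horizon r) (K r z)) powr \<gamma>"
  shows "\<exists>\<delta>>0. \<forall>y\<^sub>0. norm y\<^sub>0 \<le> \<delta> \<longrightarrow>
    (\<exists>u\<in>Lp_space p (horizon T). Lp_norm p (horizon T) u \<le> \<eta> \<and>
       \<S> T (y\<^sub>0, zero_extension T u) = 0)"
proof -
  define q where "q = (1 + \<gamma>) / 2"
  have q: "1 < q" "q < \<gamma>" using pos by (auto simp: q_def)
  obtain \<tau> A where \<tau>: "\<And>k. 0 < \<tau> k" "\<tau> sums T" and A: "0 < A"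
    and \<tau>_powr: "\<And>k::nat. \<tau> k powr (- \<sigma>) = A * q ^ k"
    using geometric_time_steps[OF \<open>0 < T\<close> q(1) \<open>0 < \<sigma>\<close>] by metis
  define \<rho> where "\<rho> = exp (- (q - 1))"
  have \<rho>: "0 < \<rho>" "\<rho> < 1" using q by (auto simp: \<rho>_def)
  \<comment> \<open>The first entry leaves a factor \<open>exp (- (q ^ k))\<close> after the control
    cost is paid; the second is the condition for propagating the state bound.\<close>
  define \<beta> where "\<beta> = max (c * A + 1) (\<gamma> * (c * A) / (\<gamma> - q))"
  have \<beta>: "c * A + 1 \<le> \<beta>" "\<gamma> * (c * A) \<le> \<beta> * (\<gamma> - q)"
    using q by (auto simp: \<beta>_def simp flip: pos_divide_le_eq)
  \<comment> \<open>The entries ensure in turn \<open>exp (- D) \<le> 1\<close>, absorption of the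
    constants in the decay step, and total control norm at most \<open>\<eta>\<close>.\<close>
  define D where "D = Max {0, ln (C\<^sub>N * (1 + C\<^sub>L) powr \<gamma>) / (\<gamma> - 1), ln (C\<^sub>L / (\<eta> * (1 - \<rho>)))}"
  have D: "0 \<le> D" "ln (C\<^sub>N * (1 + C\<^sub>L) powr \<gamma>) \<le> (\<gamma> - 1) * D"
    "ln (C\<^sub>L / (\<eta> * (1 - \<rho>))) \<le> D"
  proof -
    show "0 \<le> D" "ln (C\<^sub>L / (\<eta> * (1 - \<rho>))) \<le> D"
      unfolding D_def by (rule Max_ge; simp)+
    have "ln (C\<^sub>N * (1 + C\<^sub>L) powr \<gamma>) / (\<gamma> - 1) \<le> D"
      unfolding D_def by (rule Max_ge; simp)
    then show "ln (C\<^sub>N * (1 + C\<^sub>L) powr \<gamma>) \<le> (\<gamma> - 1) * D"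
      using pos by (simp add: pos_divide_le_eq mult.commute)
  qed
  \<comment> \<open>\<open>M k\<close> will bound the \<open>k\<close>-th state and
    \<open>a k\<close> the \<open>k\<close>-th control. The admissible radius of initial states is
    \<open>M 0\<close>.\<close>
  define M where "M k = exp (- \<beta> * q ^ k - D)" for k
  define a where "a k = C\<^sub>L * exp (- D) * \<rho> ^ k" for k
  have a_sums: "a sums (C\<^sub>L * exp (- D) * (1 / (1 - \<rho>)))"
    unfolding a_def using \<rho> by (intro sums_mult geometric_sums) auto
  have a_le: "suminf a \<le> \<eta>"
  proof -
    have "C\<^sub>L / (\<eta> * (1 - \<rho>)) \<le> exp D"
      using D(3) pos \<rho> by (metis diff_gt_0_iff_gt divide_pos_pos exp_le_cancel_iff exp_ln mult_pos_pos)
    then have "C\<^sub>L * exp (- D) * (1 / (1 - \<rho>)) \<le> \<eta>"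
      using pos \<rho> by (simp add: exp_minus field_simps)
    then show ?thesis using a_sums by (simp add: sums_iff)
  qed
  have M_le: "exp (c * A * q ^ k) * M k \<le> exp (- D) * \<rho> ^ k" for k
  proof -
    have "exp (c * A * q ^ k) * M k = exp (- D) * exp (- ((\<beta> - c * A) * q ^ k))"
      by (simp add: M_def algebra_simps flip: exp_add)
    also have "\<dots> \<le> exp (- D) * exp (- (q ^ k))"
      using \<beta>(1) q mult_right_mono[of 1 "\<beta> - c * A" "q ^ k"] by simp
    also have "\<dots> \<le> exp (- D) * \<rho> ^ k"
      using exp_neg_power_le[OF q(1), of k] by (simp add: \<rho>_def)
    finally show ?thesis .
  qed
  show ?thesis
  proof (intro exI[of _ "M 0"] conjI allI impI)
    show "0 < M 0" by (simp add: M_def)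
    fix y\<^sub>0 :: 'y assume y0: "norm y\<^sub>0 \<le> M 0"
    \<comment> \<open>Each control is computed from the state actually reached by the nonlinear
      system, so earlier linearization errors are corrected instead of accumulating.\<close>
    define y where "y = rec_nat y\<^sub>0 (\<lambda>k z. \<S> (\<tau> k) (z, zero_extension (\<tau> k) (K (\<tau> k) z)))"
    have y_0: "y 0 = y\<^sub>0"
      and y_Suc: "y (Suc k) = \<S> (\<tau> k) (y k, zero_extension (\<tau> k) (K (\<tau> k) (y k)))" for k
      by (simp_all add: y_def)
    have K_le: "Lp_norm p (horizon (\<tau> k)) (K (\<tau> k) (y k)) \<le> C\<^sub>L * exp (c * A * q ^ k) * norm (y k)" for k
      using K(2)[OF \<tau>(1)[of k], of "y k"] by (simp add: \<tau>_powr mult.assoc)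
    have y_M: "norm (y k) \<le> M k" for k
    proof (induction k)
      case 0
      show ?case using y0 by (simp add: y_0)
    next
      case (Suc k)
      have "norm (y (Suc k))
          \<le> C\<^sub>N * (norm (y k) + Lp_norm p (horizon (\<tau> k)) (K (\<tau> k) (y k))) powr \<gamma>"
        unfolding y_Suc by (rule K(3)[OF \<tau>(1)])
      also have "\<dots> \<le> exp (- \<beta> * (q * q ^ k) - D)"
        using Suc.IH K_le[of k] pos A q \<beta>(2) D(2)
        by (intro superexponential_decay_step[where \<alpha> = "c * A"]) (auto simp: M_def Lp_norm_nonneg)
      finally show ?case by (simp add: M_def)
    qed
    have "\<exists>v\<in>Lp_space p (horizon T). Lp_norm p (horizon T) v \<le> suminf a \<and>
        \<S> T (y 0, zero_extension T v) = 0"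
    proof (rule concatenate_infinitely_many_controls[OF p flow \<tau>])
      show "0 \<le> a k" for k using pos \<rho> by (simp add: a_def)
      show "summable a" using a_sums by (simp add: sums_iff)
      show "K (\<tau> k) (y k) \<in> Lp_space p (horizon (\<tau> k))" for k by (rule K(1)[OF \<tau>(1)])
      show "Lp_norm p (horizon (\<tau> k)) (K (\<tau> k) (y k)) \<le> a k" for k
      proof -
        have "C\<^sub>L * exp (c * A * q ^ k) * norm (y k) \<le> C\<^sub>L * (exp (c * A * q ^ k) * M k)"
          using y_M[of k] pos by simp
        also have "\<dots> \<le> C\<^sub>L * (exp (- D) * \<rho> ^ k)"
          using M_le[of k] pos by (intro mult_left_mono) auto
        finally show ?thesis using K_le[of k] by (simp add: a_def mult.assoc)
      qed
      show "y (Suc k) = \<S> (\<tau> k) (y k, zero_extension (\<tau> k) (K (\<tau> k) (y k)))" for k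
        by (rule y_Suc)
      show "y \<longlonglongrightarrow> 0"
      proof (rule Lim_null_comparison)
        show "\<forall>\<^sub>F k in sequentially. norm (y k) \<le> \<rho> ^ k"
        proof (intro always_eventually allI)
          fix k
          \<comment> \<open>Inserting the cost factor, which is at least 1, lets the estimate
            \<open>M_le\<close> for the controls also give convergence of the states.\<close>
          have "1 \<le> exp (c * A * q ^ k)" using pos A q by simp
          then have "M k \<le> exp (c * A * q ^ k) * M k"
            using mult_right_mono[of 1 "exp (c * A * q ^ k)" "M k"] by (simp add: M_def)
          with y_M[of k] have "norm (y k) \<le> exp (c * A * q ^ k) * M k" by (rule order_trans)
          also note M_le
          also have "exp (- D) * \<rho> ^ k \<le> 1 * \<rho> ^ k"
            using D(1) \<rho> by (intro mult_right_mono) auto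
          finally show "norm (y k) \<le> \<rho> ^ k" by simp
        qed
        show "(\<lambda>k. \<rho> ^ k) \<longlonglongrightarrow> 0" using \<rho> by (intro LIMSEQ_power_zero) auto
      qed
    qed
    then show "\<exists>u\<in>Lp_space p (horizon T). Lp_norm p (horizon T) u \<le> \<eta> \<and>
        \<S> T (y\<^sub>0, zero_extension T u) = 0"
      using a_le by (auto simp: y_0 intro: order_trans)
  qed
qed

theorem theorem3p17:
  fixes \<Sigma> \<S> :: "real \<Rightarrow> 'y::banach \<times> (real \<Rightarrow> 'u::banach) \<Rightarrow> 'y"
    and p :: ennreal
  assumes "1 \<le> p"
    and "linear_control_system p \<Sigma>"
    and "nonlinear_control_system p \<S>"
    and "\<exists>\<sigma>>0. \<exists>c>0. \<exists>C\<^sub>L>0. \<forall>T>0. \<forall>y\<^sub>0. \<exists>u \<in> Lp_space p (horizon T).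
           \<Sigma> T (y\<^sub>0, zero_extension T u) = 0 \<and>
           Lp_norm p (horizon T) u \<le> C\<^sub>L * exp (c * T powr (- \<sigma>)) * norm y\<^sub>0"
    and "\<exists>\<gamma>>1. \<exists>C\<^sub>N>0. \<forall>T>0. \<forall>y\<^sub>0. \<forall>u \<in> Lp_space p (horizon T).
           norm (\<S> T (y\<^sub>0, zero_extension T u) - \<Sigma> T (y\<^sub>0, zero_extension T u))
             \<le> C\<^sub>N * (norm y\<^sub>0 + Lp_norm p (horizon T) u) powr \<gamma>"
  shows "small_time_locally_null_controllable p \<S>"
proof -
  obtain \<sigma> c C\<^sub>L where pos: "0 < \<sigma>" "0 < c" "0 < C\<^sub>L"
    and lin: "\<forall>T>0. \<forall>y\<^sub>0. \<exists>u \<in> Lp_space p (horizon T).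
           \<Sigma> T (y\<^sub>0, zero_extension T u) = 0 \<and>
           Lp_norm p (horizon T) u \<le> C\<^sub>L * exp (c * T powr (- \<sigma>)) * norm y\<^sub>0"
    using assms(4) by blast
  obtain \<gamma> C\<^sub>N where pos': "1 < \<gamma>" "0 < C\<^sub>N"
    and nonlin: "\<forall>T>0. \<forall>y\<^sub>0. \<forall>u \<in> Lp_space p (horizon T).
           norm (\<S> T (y\<^sub>0, zero_extension T u) - \<Sigma> T (y\<^sub>0, zero_extension T u))
             \<le> C\<^sub>N * (norm y\<^sub>0 + Lp_norm p (horizon T) u) powr \<gamma>"
    using assms(5) by blast
  \<comment> \<open>A choice made for all durations and states at once provides the feedback law for
    the recursion.\<close>
  define K where "K r z = (SOME u. u \<in> Lp_space p (horizon r) \<and>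
      \<Sigma> r (z, zero_extension r u) = 0 \<and>
      Lp_norm p (horizon r) u \<le> C\<^sub>L * exp (c * r powr (- \<sigma>)) * norm z)" for r z
  have K: "K r z \<in> Lp_space p (horizon r) \<and> \<Sigma> r (z, zero_extension r (K r z)) = 0 \<and>
      Lp_norm p (horizon r) (K r z) \<le> C\<^sub>L * exp (c * r powr (- \<sigma>)) * norm z" if "0 < r" for r z
    using someI_ex[OF lin[unfolded Bex_def, rule_format, OF that, of z]] unfolding K_def .
  have K_Lp: "K r z \<in> Lp_space p (horizon r)"
    and K_null: "\<Sigma> r (z, zero_extension r (K r z)) = 0"
    and K_norm: "Lp_norm p (horizon r) (K r z) \<le> C\<^sub>L * exp (c * r powr (- \<sigma>)) * norm z"
    if "0 < r" for r z
    using K[OF that, of z] by blast+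
  \<comment> \<open>The linear end state is 0, so the difference in the closeness hypothesis is the
    nonlinear end state itself.\<close>
  have K_step: "norm (\<S> r (z, zero_extension r (K r z)))
      \<le> C\<^sub>N * (norm z + Lp_norm p (horizon r) (K r z)) powr \<gamma>" if "0 < r" for r z
    using nonlin[rule_format, OF that K_Lp[OF that], of z z] unfolding K_null[OF that] diff_zero .
  have flow: "control_flow p \<S>"
    using assms(3) by (simp add: nonlinear_control_system_def)
  show ?thesis
    unfolding small_time_locally_null_controllable_def
  proof (intro allI impI)
    fix T \<eta> :: real assume "0 < T" "0 < \<eta>"
    from null_control_with_small_norm[OF assms(1) flow pos pos' this K_Lp K_norm K_step]
    show "\<exists>\<delta>>0. \<forall>y\<^sub>0. norm y\<^sub>0 \<le> \<delta> \<longrightarrow>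
      (\<exists>u \<in> Lp_space p (horizon T).
         Lp_norm p (horizon T) u \<le> \<eta> \<and> \<S> T (y\<^sub>0, zero_extension T u) = 0)" .
  qed
qed

end
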